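(* Let $s\ge 2$, $k\ge 1$, $0\le t\le k$ and $\lambda\ge 1$ be integers, and let $\{a_c\}_{c\ge 0}$ be defined by $a_0=\lambda$ and $a_c=\lambda-\sum_{e=0}^{c-1}a_e\binom{k-t}{c-e}(s-1)^{c-e}$ for $c\ge 1$. Write $[s]=\{1,\dots,s\}$, $\mathbf 1=(1,\dots,1)\in[s]^k$, and for $\mathbf u,\mathbf v\in[s]^k$ let $d(\mathbf u,\mathbf v)$ be the number of coordinates in which they differ. For $\mathbf x\in[s]^k$ let $I_{\mathbf x}=\{i: x_i\ne 1\}$ and $J_{\mathbf x}=\{\mathbf y\in[s]^k: y_i=x_i\ \forall i\in I_{\mathbf x}\}$. Consider the system, in real variables $N_{\mathbf y}$ indexed by $\mathbf y\in[s]^k$ with $d(\mathbf 1,\mathbf y)>t$, consisting of \[ a_{t-d(\mathbf 1,\mathbf x)}+(-1)^{t-d(\mathbf 1,\mathbf x)+1}\sum_{\mathbf y\in J_{\mathbf x},\ d(\mathbf 1,\mathbf y)>t}\binom{d(\mathbf 1,\mathbf y)-d(\mathbf 1,\mathbf x)-1}{t-d(\mathbf 1,\mathbf x)}N_{\mathbf y}\ \ge 0\quad\text{for every }\mathbf x\in[s]^k\text{ with }0\le d(\mathbf 1,\mathbf x)\le t, \] together with $N_{\mathbf y}\ge 0$ for every $\mathbf y$ with $d(\mathbf 1,\mathbf y)>t$. Then an $\mathrm{OA}(\lambda s^t,k,s,t)$ exists if and only if this system has a solution in which all $N_{\mathbf y}$ are integers.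
   Context: An orthogonal array $\mathrm{OA}(N,k,s,t)$ of strength $t$ is an $N\times k$ array (factorial design with $N$ runs and $k$ factors) with entries in $\{1,\dots,s\}$ such that, for any choice of $t$ columns, each of the $s^t$ possible $t$-tuples of levels appears exactly $\lambda=N/s^t$ times as a row of the projection onto those columns. *)

theory Defs
  imports Complex_Main "HOL-Library.FuncSet"
begin

text \<open>The points of $[s]^k$ are the extensional functions from $\{1,\dots,k\}$ to $\{1,\dots,s\}$.\<close>

definition grid :: "nat \<Rightarrow> nat \<Rightarrow> (nat \<Rightarrow> nat) set" where
  "grid s k = {1..k} \<rightarrow>\<^sub>E {1..s}"

definition ones :: "nat \<Rightarrow> nat \<Rightarrow> nat" where
  "ones k = (\<lambda>i\<in>{1..k}. 1)"

definition hdist :: "nat \<Rightarrow> (nat \<Rightarrow> nat) \<Rightarrow> (nat \<Rightarrow> nat) \<Rightarrow> nat" where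
  "hdist k u v = card {i \<in> {1..k}. u i \<noteq> v i}"

text \<open>The array has rows $1,\dots,N$ and columns $1,\dots,k$; \<open>A r j\<close> is the entry in row \<open>r\<close>
  and column \<open>j\<close>. A \<open>t\<close>-tuple of levels on a set \<open>C\<close> of \<open>t\<close> columns is a function \<open>u\<close> on \<open>C\<close>.
  The division is real division, so an array of strength \<open>t\<close> forces \<open>s ^ t\<close> to divide \<open>N\<close>
  whenever \<open>s \<ge> 1\<close> and \<open>t \<le> k\<close>.\<close>

definition is_OA :: "nat \<Rightarrow> nat \<Rightarrow> nat \<Rightarrow> nat \<Rightarrow> (nat \<Rightarrow> nat \<Rightarrow> nat) \<Rightarrow> bool" where
  "is_OA N k s t A \<longleftrightarrow>
     (\<forall>r\<in>{1..N}. \<forall>j\<in>{1..k}. A r j \<in> {1..s}) \<and>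
     (\<forall>C. C \<subseteq> {1..k} \<and> card C = t \<longrightarrow>
       (\<forall>u \<in> C \<rightarrow>\<^sub>E {1..s}.
          real (card {r \<in> {1..N}. \<forall>j\<in>C. A r j = u j}) = real N / real s ^ t))"

definition exists_OA :: "nat \<Rightarrow> nat \<Rightarrow> nat \<Rightarrow> nat \<Rightarrow> bool" where
  "exists_OA N k s t \<longleftrightarrow> (\<exists>A. is_OA N k s t A)"

function a_seq :: "nat \<Rightarrow> nat \<Rightarrow> nat \<Rightarrow> nat \<Rightarrow> nat \<Rightarrow> int" where
  "a_seq lam s k t 0 = int lam"
| "a_seq lam s k t (Suc c) = int lam -
     (\<Sum>e = 0..c. a_seq lam s k t e * int ((k - t) choose (Suc c - e)) * (int s - 1) ^ (Suc c - e))"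
  by pat_completeness auto
termination
  by (relation "measure (\<lambda>(lam, s, k, t, c). c)") auto

definition I_set :: "nat \<Rightarrow> (nat \<Rightarrow> nat) \<Rightarrow> nat set" where
  "I_set k x = {i \<in> {1..k}. x i \<noteq> 1}"

definition J_set :: "nat \<Rightarrow> nat \<Rightarrow> (nat \<Rightarrow> nat) \<Rightarrow> (nat \<Rightarrow> nat) set" where
  "J_set s k x = {y \<in> grid s k. \<forall>i \<in> I_set k x. y i = x i}"

text \<open>The variables of the system are the values \<open>Nv y\<close> at the points \<open>y\<close> of the grid at distance
  more than \<open>t\<close> from the all-ones point; the other values of \<open>Nv\<close> are not used. The truncated
  subtractions are exact, because \<open>hdist k (ones k) x \<le> t < hdist k (ones k) y\<close>.\<close>

definition free_points :: "nat \<Rightarrow> nat \<Rightarrow> nat \<Rightarrow> (nat \<Rightarrow> nat) set" where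
  "free_points s k t = {y \<in> grid s k. hdist k (ones k) y > t}"

definition solves_system ::
    "nat \<Rightarrow> nat \<Rightarrow> nat \<Rightarrow> nat \<Rightarrow> ((nat \<Rightarrow> nat) \<Rightarrow> real) \<Rightarrow> bool" where
  "solves_system lam s k t Nv \<longleftrightarrow>
     (\<forall>x \<in> grid s k. hdist k (ones k) x \<le> t \<longrightarrow>
        of_int (a_seq lam s k t (t - hdist k (ones k) x))
        + (-1) ^ (t - hdist k (ones k) x + 1) *
          (\<Sum>y \<in> {y \<in> J_set s k x. hdist k (ones k) y > t}.
             real ((hdist k (ones k) y - hdist k (ones k) x - 1) choose (t - hdist k (ones k) x))
             * Nv y) \<ge> 0) \<and>
     (\<forall>y \<in> free_points s k t. Nv y \<ge> 0)"

end

theory Submission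
  imports Defs "HOL-Computational_Algebra.Formal_Power_Series"
begin

text \<open>
  Let $N_y$ count the rows of an array that are equal to $y$. Strength $t$ says that all marginals of
  $N$ on $t$ columns equal $\lambda$. Splitting marginals one coordinate at a time, this is equivalent to
  $\sum_{y \in J_x} N_y = \lambda s^{t - d(\mathbf 1, x)}$ for all $x$ with $d(\mathbf 1, x) \le t$.
  These equations are triangular with respect to $d(\mathbf 1, \cdot)$, hence they determine $N_x$ for
  $d(\mathbf 1, x) \le t$ from the values at the other points. The solution is the left-hand side of the
  inequality at $x$: the coefficient of each free $N_z$ is right by Vandermonde's convolution with a
  negative upper index, and the constant term by the generating function identity
  $A(X) (1 + (s - 1) X)^{k - t} = \lambda / (1 - X)$ for $A(X) = \sum_c a_c X^c$. So nonnegative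
  integral solutions of the system are exactly the row frequencies of orthogonal arrays.
\<close>

section \<open>Binomial identities\<close>

text \<open>Negating the upper index turns the signed factor into
  \<open>(c - m) gchoose (c - j)\<close>. The sum is then a Vandermonde convolution with total upper
  index \<open>c\<close>, and \<open>c choose c\<close> is 1. The bound \<open>c < m\<close> keeps
  \<open>m - j - 1\<close> exact.\<close>

lemma alternating_Vandermonde:
  assumes "c < m"
  shows "(\<Sum>j\<le>c. real (m choose j) * ((-1) ^ (c - j) * real ((m - j - 1) choose (c - j)))) = 1"
proof -
  have "(-1) ^ (c - j) * real ((m - j - 1) choose (c - j)) = (real c - real m) gchoose (c - j)"
    if "j \<le> c" for j
  proof -
    have "(- (real m - real c)) gchoose (c - j) =
        (-1) ^ (c - j) * ((real m - real c + real (c - j) - 1) gchoose (c - j))"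
      by (rule gbinomial_minus)
    moreover have "real m - real c + real (c - j) - 1 = real (m - j - 1)"
      using that assms by (simp add: of_nat_diff)
    ultimately show ?thesis by (simp add: binomial_gbinomial)
  qed
  then have "(\<Sum>j\<le>c. real (m choose j) * ((-1) ^ (c - j) * real ((m - j - 1) choose (c - j))))
      = (\<Sum>j\<le>c. (real m gchoose j) * ((real c - real m) gchoose (c - j)))"
    by (intro sum.cong) (auto simp: binomial_gbinomial)
  also have "\<dots> = (real m + (real c - real m)) gchoose c"
    unfolding atMost_atLeast0 by (rule gbinomial_Vandermonde)
  finally show ?thesis by (simp flip: binomial_gbinomial)
qed

text \<open>The recursion with its left side moved into the sum as the summand \<open>i = c\<close>,
  whose other factors are 1.\<close>

lemma a_seq_convolution:
  "(\<Sum>i\<le>c. a_seq lam s k t i * (int ((k - t) choose (c - i)) * (int s - 1) ^ (c - i))) = int lam"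
  by (cases c) (simp_all add: atMost_atLeast0 mult.assoc)

lemma fps_nth_one_plus_const_X_power:
  fixes q :: "'a::comm_ring_1"
  shows "fps_nth ((1 + fps_const q * fps_X) ^ n) i = of_nat (n choose i) * q ^ i"
proof -
  have "(1 + fps_const q * fps_X) ^ n = (\<Sum>j\<le>n. fps_const (of_nat (n choose j) * q ^ j) * fps_X ^ j)"
    by (subst add.commute, subst binomial_ring)
      (simp add: power_mult_distrib fps_const_power fps_of_nat mult.assoc flip: fps_const_mult)
  then show ?thesis
    by (auto simp: fps_sum_nth fps_X_power_nth if_distrib[of "(*) _"] binomial_eq_0 cong: if_cong)
qed

text \<open>With B = 1 + (s - 1) X, multiplying A B^(k - t) = lam / (1 - X) by B^c gives the
  generating function of the right coefficients. For \<open>c = t - d\<close> this evaluates the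
  constant terms summed over a set J_x with x at distance \<open>d\<close>.\<close>

lemma a_seq_binomial_sum:
  "(\<Sum>j\<le>c. int ((k - t + c) choose j) * (int s - 1) ^ j * a_seq lam s k t (c - j)) = int lam * int s ^ c"
proof -
  define q where "q = int s - 1"
  define B where "B = 1 + fps_const q * fps_X"
  define A where "A = Abs_fps (a_seq lam s k t)"
  have AB: "A * B ^ (k - t) = Abs_fps (\<lambda>_. int lam)"
    by (rule fps_ext)
      (use a_seq_convolution[of lam s k t] in
        \<open>simp add: fps_mult_nth A_def B_def q_def fps_nth_one_plus_const_X_power atMost_atLeast0\<close>)
  have "(\<Sum>j\<le>c. int ((k - t + c) choose j) * q ^ j * a_seq lam s k t (c - j))
      = fps_nth (B ^ (k - t + c) * A) c"
    by (simp add: fps_mult_nth A_def B_def fps_nth_one_plus_const_X_power atMost_atLeast0)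
  also have "B ^ (k - t + c) * A = B ^ c * (A * B ^ (k - t))"
    by (simp add: power_add mult_ac)
  \<comment> \<open>Multiplying by lam / (1 - X) takes partial sums. As B^c has degree at most
    \<open>c\<close>, its \<open>c\<close>-th partial sum is its value at X = 1, which is
    s^c.\<close>
  also have "fps_nth \<dots> c = (\<Sum>j\<le>c. int (c choose j) * q ^ j * int lam)"
    unfolding AB by (simp add: fps_mult_nth B_def fps_nth_one_plus_const_X_power atMost_atLeast0)
  also have "\<dots> = int lam * (q + 1) ^ c"
    by (subst binomial_ring) (simp add: sum_distrib_left mult_ac)
  finally show ?thesis by (simp add: q_def)
qed

lemma sum_subsets_card:
  fixes f :: "nat \<Rightarrow> 'b::comm_semiring_1"
  assumes "finite M"
  shows "(\<Sum>B\<in>Pow M. f (card B)) = (\<Sum>j\<le>card M. of_nat (card M choose j) * f j)"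
proof -
  have "(\<Sum>B\<in>Pow M. f (card B)) = (\<Sum>j\<le>card M. \<Sum>B\<in>{B \<in> Pow M. card B = j}. f (card B))"
    by (rule sum.group[symmetric]) (use assms in \<open>auto intro: card_mono\<close>)
  also have "\<dots> = (\<Sum>j\<le>card M. of_nat (card M choose j) * f j)"
    using assms by (intro sum.cong) (auto simp flip: n_subsets)
  finally show ?thesis .
qed

lemma sum_atMost_cutoff:
  fixes h F :: "nat \<Rightarrow> 'a::comm_semiring_1"
  assumes "d \<le> t" and "t \<le> d + M"
  shows "(\<Sum>j\<le>M. h j * (if d + j \<le> t then F (d + j) else 0)) = (\<Sum>j\<le>t - d. h j * F (d + j))"
  by (rule sum.mono_neutral_cong_right) (use assms in auto)

section \<open>The sets $I_x$ and $J_x$\<close>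

lemma finite_grid [simp]: "finite (grid s k)"
  by (simp add: grid_def finite_PiE)

lemma grid_outside: "y \<in> grid s k \<Longrightarrow> i \<notin> {1..k} \<Longrightarrow> y i = undefined"
  unfolding grid_def by (rule PiE_arb)

lemma finite_I_set [simp]: "finite (I_set k x)"
  by (simp add: I_set_def)

lemma finite_J_set [simp]: "finite (J_set s k x)"
  by (simp add: J_set_def)

lemma hdist_ones: "hdist k (ones k) x = card (I_set k x)"
  unfolding hdist_def I_set_def ones_def by (intro arg_cong[of _ _ card]) auto

lemma J_set_refl: "x \<in> grid s k \<Longrightarrow> x \<in> J_set s k x"
  by (simp add: J_set_def)

lemma J_set_in_grid: "y \<in> J_set s k x \<Longrightarrow> y \<in> grid s k"
  by (simp add: J_set_def)

lemma I_set_mono: "y \<in> J_set s k x \<Longrightarrow> I_set k x \<subseteq> I_set k y"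
  by (auto simp: J_set_def I_set_def)

lemma J_set_trans: "y \<in> J_set s k x \<Longrightarrow> z \<in> J_set s k y \<Longrightarrow> z \<in> J_set s k x"
  using I_set_mono[of y s k x] by (auto simp: J_set_def)

lemma I_set_subset: "I_set k x \<subseteq> {1..k}"
  by (auto simp: I_set_def)

lemma card_I_set_le: "card (I_set k x) \<le> k"
  using card_mono[OF _ I_set_subset] by simp

lemma J_set_eq_if_I_set_eq:
  assumes "x \<in> grid s k" and "y \<in> J_set s k x" and "I_set k y = I_set k x"
  shows "y = x"
proof
  fix i
  show "y i = x i"
  proof (cases "i \<in> {1..k}")
    case True
    with assms show ?thesis by (cases "i \<in> I_set k x") (auto simp: J_set_def I_set_def)
  next
    case False
    with assms show ?thesis
      using grid_outside[of x s k i] grid_outside[of y s k i] by (simp add: J_set_def)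
  qed
qed

lemma card_I_set_less:
  assumes "x \<in> grid s k" and "y \<in> J_set s k x" and "y \<noteq> x"
  shows "card (I_set k x) < card (I_set k y)"
  using assms J_set_eq_if_I_set_eq[of x s k y] I_set_mono[of y s k x]
  by (intro psubset_card_mono) auto

section \<open>Sums over J_x and over the points between x and z\<close>

text \<open>The coordinates are chosen independently: forced on \<open>I_set k x\<close>, any of the
  \<open>s - 1\<close> levels other than 1 on \<open>B\<close>, and 1 elsewhere.\<close>

lemma card_fixed_support:
  assumes x: "x \<in> grid s k" and s: "s \<ge> 1" and B: "B \<subseteq> {1..k} - I_set k x"
  shows "card {y \<in> J_set s k x. I_set k y - I_set k x = B} = (s - 1) ^ card B"
proof -
  let ?T = "\<lambda>i. if i \<in> I_set k x then {x i} else if i \<in> B then {2..s} else {1}"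
  have fB: "finite B" using B finite_subset by blast
  have *: "y \<in> J_set s k x \<and> I_set k y - I_set k x = B \<longleftrightarrow> y \<in> PiE {1..k} ?T" (is "?L \<longleftrightarrow> ?R") for y
  proof
    assume L: ?L
    show ?R
    proof (rule PiE_I)
      fix i assume i: "i \<in> {1..k}"
      with L have "y i \<in> {1..s}" by (auto simp: J_set_def grid_def)
      moreover have "i \<in> B \<longleftrightarrow> y i \<noteq> 1 \<and> i \<notin> I_set k x" using L i by (auto simp: I_set_def)
      moreover have "i \<in> I_set k x \<Longrightarrow> y i = x i" using L by (auto simp: J_set_def)
      ultimately show "y i \<in> ?T i" by auto
    next
      fix i assume "i \<notin> {1..k}"
      then show "y i = undefined" using L by (intro grid_outside[OF J_set_in_grid]) auto
    qed
  next
    assume R: ?R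
    have y: "y i \<in> ?T i" if "i \<in> {1..k}" for i using R that by (rule PiE_mem)
    have "y \<in> grid s k" unfolding grid_def
    proof (rule PiE_I)
      fix i assume "i \<in> {1..k}"
      then show "y i \<in> {1..s}" using y[of i] x s by (auto simp: grid_def split: if_splits)
    next
      fix i assume "i \<notin> {1..k}"
      then show "y i = undefined" by (rule PiE_arb[OF R])
    qed
    moreover have "\<forall>i\<in>I_set k x. y i = x i"
      using y by (force simp: I_set_def)
    moreover have "i \<in> I_set k y - I_set k x \<longleftrightarrow> i \<in> B" for i
      using y[of i] B by (cases "i \<in> {1..k}") (auto simp: I_set_def[of k y] split: if_splits)
    ultimately show ?L by (auto simp: J_set_def)
  qed
  have "card {y \<in> J_set s k x. I_set k y - I_set k x = B} = card (PiE {1..k} ?T)"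
    using * by (intro arg_cong[of _ _ card]) blast
  also have "\<dots> = (\<Prod>i\<in>{1..k}. card (?T i))" by (simp add: card_PiE)
  also have "\<dots> = (\<Prod>i\<in>B. s - 1)"
    by (rule prod.mono_neutral_cong_right) (use B in auto)
  finally show ?thesis by simp
qed

text \<open>Points of J_x are grouped by the set \<open>B\<close> of coordinates by which they
  enlarge I_x, and these sets by their size.\<close>

lemma sum_J_set_weight:
  fixes f :: "nat \<Rightarrow> real"
  assumes x: "x \<in> grid s k" and s: "s \<ge> 1"
  defines "d \<equiv> card (I_set k x)"
  shows "(\<Sum>y\<in>J_set s k x. f (card (I_set k y))) =
    (\<Sum>j\<le>k - d. real ((k - d) choose j) * (real s - 1) ^ j * f (d + j))"
proof -
  let ?M = "{1..k} - I_set k x"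
  have M: "card ?M = k - d"
    using card_Diff_subset[OF finite_I_set I_set_subset] by (simp add: d_def)
  have "(\<Sum>y\<in>J_set s k x. f (card (I_set k y))) =
      (\<Sum>B\<in>Pow ?M. \<Sum>y\<in>{y \<in> J_set s k x. I_set k y - I_set k x = B}. f (card (I_set k y)))"
    by (rule sum.group[symmetric]) (auto simp: I_set_def)
  also have "\<dots> = (\<Sum>B\<in>Pow ?M. (real s - 1) ^ card B * f (d + card B))"
  proof (rule sum.cong)
    fix B assume B: "B \<in> Pow ?M"
    have "card (I_set k y) = d + card B" if "y \<in> J_set s k x" "I_set k y - I_set k x = B" for y
    proof -
      have "I_set k y = I_set k x \<union> B" using that I_set_mono by blast
      then show ?thesis
        using B finite_subset[of B ?M] by (auto simp: d_def intro!: card_Un_disjoint)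
    qed
    then have "(\<Sum>y\<in>{y \<in> J_set s k x. I_set k y - I_set k x = B}. f (card (I_set k y))) =
        (\<Sum>y\<in>{y \<in> J_set s k x. I_set k y - I_set k x = B}. f (d + card B))"
      by (intro sum.cong) auto
    then show "(\<Sum>y\<in>{y \<in> J_set s k x. I_set k y - I_set k x = B}. f (card (I_set k y))) =
        (real s - 1) ^ card B * f (d + card B)"
      using B s by (simp add: card_fixed_support[OF x s] of_nat_diff)
  qed simp
  also have "\<dots> = (\<Sum>j\<le>card ?M. real (card ?M choose j) * ((real s - 1) ^ j * f (d + j)))"
    using sum_subsets_card[of ?M "\<lambda>j. (real s - 1) ^ j * f (d + j)"] by simp
  finally show ?thesis by (simp only: M mult.assoc)
qed

text \<open>A point between \<open>x\<close> and \<open>z\<close> copies \<open>z\<close> on its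
  support and is 1 elsewhere, so its support determines it. These points thus form a Boolean lattice
  on I_z - I_x, without the powers of \<open>s - 1\<close> that occur for all of J_x.\<close>

lemma sum_between_weight:
  fixes f :: "nat \<Rightarrow> real"
  assumes x: "x \<in> grid s k" and z: "z \<in> J_set s k x" and s: "s \<ge> 1"
  defines "d \<equiv> card (I_set k x)" and "m \<equiv> card (I_set k z) - card (I_set k x)"
  shows "(\<Sum>y\<in>{y \<in> J_set s k x. z \<in> J_set s k y}. f (card (I_set k y))) =
    (\<Sum>j\<le>m. real (m choose j) * f (d + j))"
proof -
  let ?M = "I_set k z - I_set k x"
  let ?y = "\<lambda>B. \<lambda>i\<in>{1..k}. if i \<in> I_set k x \<union> B then z i else 1"
  have zg: "z \<in> grid s k" using z J_set_in_grid by blast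
  have M: "card ?M = m"
    unfolding m_def by (rule card_Diff_subset) (use I_set_mono[OF z] in auto)
  have Iy: "I_set k (?y B) = I_set k x \<union> B" if "B \<subseteq> ?M" for B
    using that I_set_mono[OF z] by (auto simp: I_set_def)
  have yg: "?y B \<in> grid s k" for B
    using zg s by (auto simp: grid_def PiE_def Pi_def)
  have "(\<Sum>y\<in>{y \<in> J_set s k x. z \<in> J_set s k y}. f (card (I_set k y))) =
      (\<Sum>B\<in>Pow ?M. f (d + card B))"
  proof (rule sum.reindex_bij_witness[of _ ?y "\<lambda>y. I_set k y - I_set k x"])
    fix y assume y: "y \<in> {y \<in> J_set s k x. z \<in> J_set s k y}"
    have I: "I_set k x \<union> (I_set k y - I_set k x) = I_set k y"
      using y I_set_mono by blast
    show "?y (I_set k y - I_set k x) = y"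
    proof
      fix i show "?y (I_set k y - I_set k x) i = y i"
        unfolding I using y grid_outside[of y s k i]
        by (cases "i \<in> {1..k}") (auto simp: J_set_def I_set_def)
    qed
    show "I_set k y - I_set k x \<in> Pow ?M" using y I_set_mono[of z s k y] by blast
    have "card (I_set k y) = d + card (I_set k y - I_set k x)"
      unfolding d_def by (subst card_Un_disjoint[symmetric]) (auto simp only: I finite_I_set finite_Diff)
    then show "f (d + card (I_set k y - I_set k x)) = f (card (I_set k y))" by simp
  next
    fix B assume B: "B \<in> Pow ?M"
    then show "I_set k (?y B) - I_set k x = B" using Iy[of B] by blast
    have "z \<in> J_set s k (?y B)" unfolding J_set_def using Iy[of B] B zg
      by (auto simp: I_set_def)
    moreover have "?y B \<in> J_set s k x" unfolding J_set_def using yg[of B] z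
      by (auto simp: J_set_def I_set_def)
    ultimately show "?y B \<in> {y \<in> J_set s k x. z \<in> J_set s k y}" by blast
  qed
  also have "\<dots> = (\<Sum>j\<le>card ?M. real (card ?M choose j) * f (d + j))"
    using sum_subsets_card[of ?M "\<lambda>j. f (d + j)"] by simp
  finally show ?thesis by (simp only: M)
qed

section \<open>Solving the triangular system\<close>

text \<open>The left-hand side of the inequality at \<open>x\<close>, read as the value that the
  free points force at \<open>x\<close>.\<close>

definition dependent_value ::
    "nat \<Rightarrow> nat \<Rightarrow> nat \<Rightarrow> nat \<Rightarrow> ((nat \<Rightarrow> nat) \<Rightarrow> real) \<Rightarrow> (nat \<Rightarrow> nat) \<Rightarrow> real" where
  "dependent_value lam s k t N x =
     of_int (a_seq lam s k t (t - card (I_set k x))) + (-1) ^ (t - card (I_set k x) + 1) *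
       (\<Sum>y\<in>{y \<in> J_set s k x. card (I_set k y) > t}.
          real ((card (I_set k y) - card (I_set k x) - 1) choose (t - card (I_set k x))) * N y)"

text \<open>Extends the free values to the whole grid, so that both kinds of inequality in the
  system become nonnegativity of one function.\<close>

definition completion ::
    "nat \<Rightarrow> nat \<Rightarrow> nat \<Rightarrow> nat \<Rightarrow> ((nat \<Rightarrow> nat) \<Rightarrow> real) \<Rightarrow> (nat \<Rightarrow> nat) \<Rightarrow> real" where
  "completion lam s k t N x =
     (if card (I_set k x) \<le> t then dependent_value lam s k t N x else N x)"

lemma solves_system_iff:
  "solves_system lam s k t N \<longleftrightarrow> (\<forall>x\<in>grid s k. completion lam s k t N x \<ge> 0)"
  unfolding solves_system_def free_points_def completion_def dependent_value_def hdist_ones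
  by (auto simp: not_le)

text \<open>The constant terms alone add up to the right side. Each free \<open>N z\<close> receives
  total coefficient -1 from the dependent values, which cancels its own occurrence in the
  sum.\<close>

lemma sum_completion:
  assumes x: "x \<in> grid s k" and s: "s \<ge> 1" and "t \<le> k" and d: "card (I_set k x) \<le> t"
  shows "(\<Sum>y\<in>J_set s k x. completion lam s k t N y) = real lam * real s ^ (t - card (I_set k x))"
proof -
  let ?d = "\<lambda>y. card (I_set k y)"
  let ?L = "{y \<in> J_set s k x. ?d y \<le> t}" and ?H = "{y \<in> J_set s k x. ?d y > t}"
  let ?F = "\<lambda>z e. (-1) ^ (t - e + 1) * real ((?d z - e - 1) choose (t - e))"
  let ?c = "t - ?d x"
  have const: "(\<Sum>y\<in>?L. of_int (a_seq lam s k t (t - ?d y))) = real lam * real s ^ ?c"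
  proof -
    have "(\<Sum>y\<in>?L. of_int (a_seq lam s k t (t - ?d y))) =
        (\<Sum>y\<in>J_set s k x. if ?d y \<le> t then real_of_int (a_seq lam s k t (t - ?d y)) else 0)"
      by (simp add: sum.inter_filter)
    also have "\<dots> = (\<Sum>j\<le>k - ?d x. real ((k - ?d x) choose j) * (real s - 1) ^ j *
        (if ?d x + j \<le> t then real_of_int (a_seq lam s k t (t - (?d x + j))) else 0))"
      by (rule sum_J_set_weight[OF x s])
    also have "\<dots> = (\<Sum>j\<le>?c. real ((k - ?d x) choose j) * (real s - 1) ^ j *
        real_of_int (a_seq lam s k t (t - (?d x + j))))"
      by (rule sum_atMost_cutoff[OF d]) (use \<open>t \<le> k\<close> d in simp)
    \<comment> \<open>Here \<open>k - ?d x = k - t + ?c\<close>, which is the upper index in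
      \<open>a_seq_binomial_sum\<close>.\<close>
    also have "\<dots> = of_int (\<Sum>j\<le>?c. int ((k - t + ?c) choose j) * (int s - 1) ^ j *
        a_seq lam s k t (?c - j))"
      using d \<open>t \<le> k\<close> by simp
    finally show ?thesis unfolding a_seq_binomial_sum by simp
  qed
  \<comment> \<open>\<open>?F z e\<close> is the coefficient of \<open>N z\<close> in the dependent
    value at a point at distance \<open>e\<close>. Only points between \<open>x\<close> and
    \<open>z\<close> contribute.\<close>
  have coeff: "(\<Sum>y\<in>{y \<in> ?L. z \<in> J_set s k y}. ?F z (?d y)) = -1" if z: "z \<in> ?H" for z
  proof -
    have zJ: "z \<in> J_set s k x" and zt: "t < ?d z" using z by auto
    let ?m = "?d z - ?d x"
    have "(\<Sum>y\<in>{y \<in> ?L. z \<in> J_set s k y}. ?F z (?d y)) =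
        (\<Sum>y\<in>{y \<in> J_set s k x. z \<in> J_set s k y}. if ?d y \<le> t then ?F z (?d y) else 0)"
      by (simp add: sum.inter_filter[symmetric] conj_ac)
    also have "\<dots> = (\<Sum>j\<le>?m. real (?m choose j) * (if ?d x + j \<le> t then ?F z (?d x + j) else 0))"
      by (rule sum_between_weight[OF x zJ s])
    also have "\<dots> = (\<Sum>j\<le>?c. real (?m choose j) * ?F z (?d x + j))"
      by (rule sum_atMost_cutoff[OF d]) (use zt in simp)
    \<comment> \<open>The overall sign comes from the \<open>+ 1\<close> in the exponent of
      \<open>?F\<close>.\<close>
    also have "\<dots> = - (\<Sum>j\<le>?c. real (?m choose j) *
        ((-1) ^ (?c - j) * real ((?m - j - 1) choose (?c - j))))"
      by (simp add: sum_negf)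
    also have "\<dots> = -1"
      using alternating_Vandermonde[of ?c ?m] zt d by simp
    finally show ?thesis .
  qed
  \<comment> \<open>Brings the inner index set into a form in which the two summations can be
    exchanged.\<close>
  have J: "{z \<in> J_set s k y. ?d z > t} = {z \<in> ?H. z \<in> J_set s k y}" if "y \<in> ?L" for y
    using that J_set_trans by blast
  have "(\<Sum>y\<in>J_set s k x. completion lam s k t N y) =
      (\<Sum>y\<in>?L. completion lam s k t N y) + (\<Sum>y\<in>?H. completion lam s k t N y)"
    by (subst sum.union_disjoint[symmetric]) (auto intro!: sum.cong)
  also have "(\<Sum>y\<in>?H. completion lam s k t N y) = (\<Sum>z\<in>?H. N z)"
    by (auto simp: completion_def)
  also have "(\<Sum>y\<in>?L. completion lam s k t N y) =
      (\<Sum>y\<in>?L. of_int (a_seq lam s k t (t - ?d y)) +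
        (\<Sum>z\<in>{z \<in> ?H. z \<in> J_set s k y}. ?F z (?d y) * N z))"
    by (intro sum.cong refl, subst J[symmetric])
      (simp_all add: completion_def dependent_value_def sum_distrib_left mult.assoc sum_negf)
  also have "\<dots> = real lam * real s ^ ?c +
      (\<Sum>y\<in>?L. \<Sum>z\<in>{z \<in> ?H. z \<in> J_set s k y}. ?F z (?d y) * N z)"
    by (simp only: sum.distrib const)
  also have "(\<Sum>y\<in>?L. \<Sum>z\<in>{z \<in> ?H. z \<in> J_set s k y}. ?F z (?d y) * N z) =
      (\<Sum>z\<in>?H. \<Sum>y\<in>{y \<in> ?L. z \<in> J_set s k y}. ?F z (?d y) * N z)"
    by (rule sum.swap_restrict) auto
  also have "\<dots> = (\<Sum>z\<in>?H. - N z)"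
  proof (rule sum.cong[OF refl])
    fix z assume "z \<in> ?H"
    from coeff[OF this] show "(\<Sum>y\<in>{y \<in> ?L. z \<in> J_set s k y}. ?F z (?d y) * N z) = - N z"
      by (simp only: sum_distrib_right[symmetric])
  qed
  also have "\<dots> = - (\<Sum>z\<in>?H. N z)" by (rule sum_negf)
  finally show ?thesis by simp
qed

text \<open>\<open>N\<close> and its completion satisfy the same equations and agree at the free
  points. Induction runs from the farthest points towards \<open>ones k\<close>: once all other
  points of J_x agree, the equation at \<open>x\<close> leaves one value.\<close>

lemma completion_unique:
  assumes s: "s \<ge> 1" and t: "t \<le> k"
    and N: "\<And>x. x \<in> grid s k \<Longrightarrow> card (I_set k x) \<le> t \<Longrightarrow>
      (\<Sum>y\<in>J_set s k x. N y) = real lam * real s ^ (t - card (I_set k x))"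
    and x: "x \<in> grid s k"
  shows "completion lam s k t N x = N x"
  using x
proof (induction "k - card (I_set k x)" arbitrary: x rule: less_induct)
  case less
  show ?case
  proof (cases "card (I_set k x) \<le> t")
    case True
    have "completion lam s k t N y = N y" if "y \<in> J_set s k x - {x}" for y
    proof (rule less.hyps)
      have "card (I_set k x) < card (I_set k y)"
        using card_I_set_less[OF less.prems] that by blast
      then show "k - card (I_set k y) < k - card (I_set k x)"
        using card_I_set_le[of k y] by linarith
      show "y \<in> grid s k" using that J_set_in_grid by blast
    qed
    then have "(\<Sum>y\<in>J_set s k x - {x}. completion lam s k t N y) = (\<Sum>y\<in>J_set s k x - {x}. N y)"
      by (rule sum.cong[OF refl])
    moreover have "(\<Sum>y\<in>J_set s k x. completion lam s k t N y) = (\<Sum>y\<in>J_set s k x. N y)"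
      using sum_completion[OF less.prems s t True] N[OF less.prems True] by simp
    ultimately show ?thesis
      using J_set_refl[OF less.prems] by (simp add: sum.remove[of _ x])
  qed (simp add: completion_def)
qed

section \<open>Frequencies of rows\<close>

definition marginal ::
    "nat \<Rightarrow> nat \<Rightarrow> ((nat \<Rightarrow> nat) \<Rightarrow> real) \<Rightarrow> nat set \<Rightarrow> (nat \<Rightarrow> nat) \<Rightarrow> real" where
  "marginal s k N D u = (\<Sum>y\<in>{y \<in> grid s k. \<forall>i\<in>D. y i = u i}. N y)"

lemma marginal_I_set: "marginal s k N (I_set k x) x = (\<Sum>y\<in>J_set s k x. N y)"
  by (simp add: marginal_def J_set_def)

lemma marginal_cong: "(\<And>i. i \<in> D \<Longrightarrow> u i = v i) \<Longrightarrow> marginal s k N D u = marginal s k N D v"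
  unfolding marginal_def by (intro sum.cong) auto

lemma marginal_split:
  assumes "i \<in> {1..k}" and "i \<notin> D"
  shows "marginal s k N D u = (\<Sum>v\<in>{1..s}. marginal s k N (insert i D) (u(i := v)))"
proof -
  let ?S = "{y \<in> grid s k. \<forall>i\<in>D. y i = u i}"
  have "marginal s k N D u = (\<Sum>v\<in>{1..s}. \<Sum>y\<in>{y \<in> ?S. y i = v}. N y)"
    unfolding marginal_def
    using assms by (intro sum.group[symmetric]) (auto, auto simp: grid_def)
  also have "\<dots> = (\<Sum>v\<in>{1..s}. marginal s k N (insert i D) (u(i := v)))"
    unfolding marginal_def
    by (intro sum.cong) (use assms in auto)
  finally show ?thesis .
qed

text \<open>While \<open>D\<close> has fewer than \<open>t\<close> columns, \<open>t \<le> k\<close>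
  provides a further one, and splitting along it gives \<open>s\<close> equal marginals.\<close>

lemma marginal_small:
  assumes N: "\<And>C u. C \<subseteq> {1..k} \<Longrightarrow> card C = t \<Longrightarrow> u \<in> C \<rightarrow> {1..s} \<Longrightarrow> marginal s k N C u = L"
    and t: "t \<le> k" and "D \<subseteq> {1..k}" and "card D \<le> t" and "u \<in> D \<rightarrow> {1..s}"
  shows "marginal s k N D u = L * real s ^ (t - card D)"
  using assms(3-)
proof (induction "t - card D" arbitrary: D u)
  case 0
  then show ?case using N by simp
next
  case (Suc n)
  have fin: "finite D" using Suc.prems finite_subset by blast
  have "D \<noteq> {1..k}" using Suc.hyps(2) t by auto
  then obtain i where i: "i \<in> {1..k}" "i \<notin> D" using Suc.prems by blast
  have "marginal s k N (insert i D) (u(i := v)) = L * real s ^ n" if "v \<in> {1..s}" for v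
  proof -
    have n: "n = t - card (insert i D)" using Suc.hyps(2) i fin by simp
    show ?thesis
      unfolding n
      by (rule Suc.hyps(1)[OF n]) (use Suc.hyps(2) Suc.prems i fin that in \<open>auto simp: Pi_def\<close>)
  qed
  then have "marginal s k N D u = real s * (L * real s ^ n)"
    by (simp add: marginal_split[OF i])
  then show ?case using Suc.hyps(2)[symmetric] by simp
qed

text \<open>A coordinate of \<open>u\<close> equal to 1 is traded for the marginal without that coordinate and the
  marginals in which it takes one of the other \<open>s - 1\<close> levels.\<close>

lemma marginal_from_J_set:
  assumes N: "\<And>x. x \<in> grid s k \<Longrightarrow> card (I_set k x) \<le> t \<Longrightarrow>
      (\<Sum>y\<in>J_set s k x. N y) = L * real s ^ (t - card (I_set k x))"
    and s: "s \<ge> 1" and "D \<subseteq> {1..k}" and "card D \<le> t" and "u \<in> D \<rightarrow> {1..s}"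
  shows "marginal s k N D u = L * real s ^ (t - card D)"
  using assms(3-)
proof (induction "card {i \<in> D. u i = 1}" arbitrary: D u)
  \<comment> \<open>Without entries 1, \<open>u\<close> extended by ones is a grid point with I-set
    \<open>D\<close>, so the marginal is a sum over its J-set.\<close>
  case 0
  have fin: "finite D" using 0 finite_subset by blast
  then have u: "u i \<noteq> 1" if "i \<in> D" for i using 0 that by auto
  let ?x = "\<lambda>i\<in>{1..k}. if i \<in> D then u i else 1"
  have I: "I_set k ?x = D" using 0 u by (auto simp: I_set_def)
  have "?x \<in> grid s k" using 0 s by (auto simp: grid_def PiE_def Pi_def)
  from N[OF this] have "marginal s k N D ?x = L * real s ^ (t - card D)"
    using 0 marginal_I_set[of s k N ?x] unfolding I by simp
  moreover have "marginal s k N D ?x = marginal s k N D u"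
    using 0 by (intro marginal_cong) auto
  ultimately show ?case by simp
next
  case (Suc n)
  have fin: "finite D" using Suc.prems finite_subset by blast
  have "card {i \<in> D. u i = 1} > 0" using Suc.hyps(2) by simp
  then obtain i where i: "i \<in> D" "u i = 1" by (auto simp: card_gt_0_iff)
  define E where "E = D - {i}"
  have D: "D = insert i E" and iE: "i \<notin> E" using i by (auto simp: E_def)
  have ik: "i \<in> {1..k}" using i Suc.prems by blast
  have cD: "card D = Suc (card E)" using fin iE by (simp add: D)
  have S: "{j \<in> D. u j = 1} = insert i {j \<in> E. u j = 1}" using i by (auto simp: D)
  have n: "n = card {j \<in> E. u j = 1}" using Suc.hyps(2) fin iE unfolding S by (simp add: E_def)
  \<comment> \<open>Both the marginal without column \<open>i\<close> and those with another level
    at \<open>i\<close> have one entry 1 fewer, so induction covers them.\<close>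
  have E: "marginal s k N E u = L * real s ^ (t - card E)"
    by (rule Suc.hyps(1)[OF n]) (use Suc.prems cD in \<open>auto simp: D\<close>)
  have other: "marginal s k N D (u(i := v)) = L * real s ^ (t - card D)" if "v \<in> {1..s} - {1}" for v
  proof (rule Suc.hyps(1))
    have "{j \<in> D. (u(i := v)) j = 1} = {j \<in> E. u j = 1}" using that iE by (auto simp: D)
    then show "n = card {j \<in> D. (u(i := v)) j = 1}" using n by simp
  qed (use Suc.prems that in \<open>auto simp: Pi_def\<close>)
  have "marginal s k N E u = (\<Sum>v\<in>{1..s}. marginal s k N D (u(i := v)))"
    unfolding D by (rule marginal_split[OF ik iE])
  also have "\<dots> = marginal s k N D (u(i := 1)) + (\<Sum>v\<in>{1..s} - {1}. marginal s k N D (u(i := v)))"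
    using s by (subst sum.remove[of _ 1]) auto
  also have "u(i := 1) = u" using i by auto
  also have "(\<Sum>v\<in>{1..s} - {1}. marginal s k N D (u(i := v))) = (real s - 1) * (L * real s ^ (t - card D))"
    using other s by (simp add: of_nat_diff)
  finally have "marginal s k N D u = L * real s ^ (t - card E) - (real s - 1) * (L * real s ^ (t - card D))"
    using E by simp
  moreover have "t - card E = Suc (t - card D)" using cD Suc.prems by simp
  ultimately show ?case by (simp add: algebra_simps)
qed

section \<open>Passing between arrays and row frequencies\<close>

text \<open>The rows showing \<open>u\<close> on \<open>C\<close> are sorted by the grid point they
  represent. Restriction is needed because \<open>A r\<close> is arbitrary outside
  \<open>{1..k}\<close>, while grid points are extensional.\<close>

lemma marginal_row_frequency:
  assumes A: "\<And>r j. r \<in> R \<Longrightarrow> j \<in> {1..k} \<Longrightarrow> A r j \<in> {1..s}"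
    and "finite R" and C: "C \<subseteq> {1..k}"
  shows "marginal s k (\<lambda>y. real (card {r \<in> R. restrict (A r) {1..k} = y})) C u =
    real (card {r \<in> R. \<forall>j\<in>C. A r j = u j})"
proof -
  let ?row = "\<lambda>r. restrict (A r) {1..k}"
  let ?S = "{r \<in> R. \<forall>j\<in>C. A r j = u j}" and ?T = "{y \<in> grid s k. \<forall>i\<in>C. y i = u i}"
  have "real (card ?S) = (\<Sum>y\<in>?T. \<Sum>r\<in>{r \<in> ?S. ?row r = y}. 1)"
  proof (subst sum.group)
    show "?row ` ?S \<subseteq> ?T" using C A by (auto simp: grid_def subset_iff)
  qed (use \<open>finite R\<close> in simp_all)
  also have "\<dots> = (\<Sum>y\<in>?T. real (card {r \<in> R. ?row r = y}))"
  proof (intro sum.cong refl)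
    fix y assume y: "y \<in> ?T"
    have "{r \<in> ?S. ?row r = y} = {r \<in> R. ?row r = y}"
      using y C by (auto simp: subset_iff)
    then show "(\<Sum>r\<in>{r \<in> ?S. ?row r = y}. 1) = real (card {r \<in> R. ?row r = y})" by simp
  qed
  finally show ?thesis by (simp add: marginal_def)
qed

text \<open>Numbers the disjoint union of \<open>n y\<close> labelled copies of each
  \<open>y\<close> by \<open>{1..M}\<close> and forgets the labels.\<close>

lemma row_enumeration:
  fixes n :: "(nat \<Rightarrow> nat) \<Rightarrow> nat"
  assumes "(\<Sum>y\<in>grid s k. n y) = M"
  obtains A where "\<And>r. r \<in> {1..M} \<Longrightarrow> A r \<in> grid s k"
    and "\<And>y. y \<in> grid s k \<Longrightarrow> card {r \<in> {1..M}. A r = y} = n y"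
proof -
  let ?S = "SIGMA y:grid s k. {..<n y}"
  have "card {1..M} = card ?S" using assms by simp
  then obtain f where f: "bij_betw f {1..M} ?S"
    using finite_same_card_bij[of "{1..M}" ?S] by auto
  show thesis
  proof (rule that[of "fst \<circ> f"])
    fix r assume "r \<in> {1..M}"
    then have "f r \<in> ?S" using f bij_betwE by blast
    then show "(fst \<circ> f) r \<in> grid s k" by auto
  next
    fix y assume y: "y \<in> grid s k"
    have "bij_betw f {r \<in> {1..M}. (fst \<circ> f) r = y} ({y} \<times> {..<n y})"
    proof (rule bij_betw_subset[OF f])
      show "f ` {r \<in> {1..M}. (fst \<circ> f) r = y} = {y} \<times> {..<n y}"
      proof (intro equalityI subsetI)
        fix z assume "z \<in> f ` {r \<in> {1..M}. (fst \<circ> f) r = y}"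
        then obtain r where r: "r \<in> {1..M}" "fst (f r) = y" "z = f r" by auto
        then have "f r \<in> ?S" using bij_betwE[OF f] by blast
        then show "z \<in> {y} \<times> {..<n y}" using r by (cases z) auto
      next
        fix z assume z: "z \<in> {y} \<times> {..<n y}"
        then have "z \<in> f ` {1..M}" using y bij_betw_imp_surj_on[OF f] by auto
        then obtain r where "r \<in> {1..M}" "z = f r" by blast
        then show "z \<in> f ` {r \<in> {1..M}. (fst \<circ> f) r = y}" using z by auto
      qed
    qed auto
    then show "card {r \<in> {1..M}. (fst \<circ> f) r = y} = n y"
      by (simp add: bij_betw_same_card card_cartesian_product)
  qed
qed

theorem theorem2:
  fixes s k t lam :: nat
  assumes "s \<ge> 2" and "k \<ge> 1" and "t \<le> k" and "lam \<ge> 1"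
  shows "exists_OA (lam * s ^ t) k s t \<longleftrightarrow>
    (\<exists>Nv :: (nat \<Rightarrow> nat) \<Rightarrow> real.
       solves_system lam s k t Nv \<and> (\<forall>y \<in> free_points s k t. Nv y \<in> \<int>))"
proof
  have s: "s \<ge> 1" using assms by simp
  let ?M = "lam * s ^ t"
  have M: "real ?M / real s ^ t = real lam" using assms by simp
  {
    assume "exists_OA ?M k s t"
    then obtain A where A: "is_OA ?M k s t A" by (auto simp: exists_OA_def)
    define N where "N = (\<lambda>y. real (card {r \<in> {1..?M}. restrict (A r) {1..k} = y}))"
    have "marginal s k N C u = real lam" if C: "C \<subseteq> {1..k}" "card C = t" and u: "u \<in> C \<rightarrow> {1..s}" for C u
    proof -
      have "marginal s k N C u = marginal s k N C (restrict u C)" by (rule marginal_cong) simp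
      also have "\<dots> = real (card {r \<in> {1..?M}. \<forall>j\<in>C. A r j = restrict u C j})"
        unfolding N_def by (rule marginal_row_frequency) (use A C in \<open>auto simp: is_OA_def\<close>)
      also have "\<dots> = real ?M / real s ^ t"
        using A C restrict_PiE_iff[of u C "\<lambda>_. {1..s}"] u unfolding is_OA_def by blast
      finally show ?thesis using M by simp
    qed
    note small = marginal_small[OF this \<open>t \<le> k\<close>]
    have "(\<Sum>y\<in>J_set s k x. N y) = real lam * real s ^ (t - card (I_set k x))"
      if "x \<in> grid s k" "card (I_set k x) \<le> t" for x
      unfolding marginal_I_set[symmetric]
      by (rule small) (use that in \<open>auto simp: I_set_def grid_def\<close>)
    \<comment> \<open>The frequencies satisfy all the equations, so they equal their completion,
      which is therefore nonnegative.\<close>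
    from completion_unique[OF s \<open>t \<le> k\<close> this]
    have "solves_system lam s k t N" by (simp add: solves_system_iff N_def)
    moreover have "\<forall>y\<in>free_points s k t. N y \<in> \<int>" by (simp add: N_def)
    ultimately show "\<exists>Nv. solves_system lam s k t Nv \<and> (\<forall>y\<in>free_points s k t. Nv y \<in> \<int>)" by blast
  next
    assume "\<exists>Nv. solves_system lam s k t Nv \<and> (\<forall>y\<in>free_points s k t. Nv y \<in> \<int>)"
    then obtain Nv where sol: "solves_system lam s k t Nv"
      and int: "\<And>y. y \<in> free_points s k t \<Longrightarrow> Nv y \<in> \<int>" by blast
    define N where "N = completion lam s k t Nv"
    \<comment> \<open>The dependent values are integral because the \<open>a_seq\<close> values and
      the binomial coefficients are integers.\<close>
    have N_int: "N x \<in> \<int>" if "x \<in> grid s k" for x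
    proof -
      have *: "Nv y \<in> \<int>" if "y \<in> grid s k" "t < card (I_set k y)" for y
        using int[of y] that by (simp add: free_points_def hdist_ones)
      then show ?thesis
        using that J_set_in_grid[of _ s k x]
        unfolding N_def completion_def dependent_value_def
        by (auto intro!: Ints_add Ints_mult Ints_sum Ints_minus Ints_power)
    qed
    define n where "n = (\<lambda>x. nat \<lfloor>N x\<rfloor>)"
    have n: "real (n x) = N x" if "x \<in> grid s k" for x
      using N_int[OF that] sol that by (auto simp: n_def N_def solves_system_iff elim!: Ints_cases)
    have J: "(\<Sum>y\<in>J_set s k x. N y) = real lam * real s ^ (t - card (I_set k x))"
      if "x \<in> grid s k" "card (I_set k x) \<le> t" for x
      unfolding N_def by (rule sum_completion[OF that(1) s \<open>t \<le> k\<close> that(2)])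
    note marg = marginal_from_J_set[OF J s]
    \<comment> \<open>The marginal on no columns is the total number of rows.\<close>
    have "real (\<Sum>y\<in>grid s k. n y) = marginal s k N {} undefined"
      by (simp add: marginal_def n)
    also have "\<dots> = real ?M" by (subst marg) auto
    finally have "(\<Sum>y\<in>grid s k. n y) = ?M" by (simp only: of_nat_eq_iff)
    then obtain A where Ag: "\<And>r. r \<in> {1..?M} \<Longrightarrow> A r \<in> grid s k"
      and An: "\<And>y. y \<in> grid s k \<Longrightarrow> card {r \<in> {1..?M}. A r = y} = n y"
      by (rule row_enumeration) blast
    have As: "A r j \<in> {1..s}" if "r \<in> {1..?M}" "j \<in> {1..k}" for r j
      using Ag[OF that(1)] that(2) by (auto simp: grid_def)
    have res: "restrict (A r) {1..k} = A r" if "r \<in> {1..?M}" for r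
      using Ag[OF that] by (simp add: grid_def PiE_restrict)
    have "real (card {r \<in> {1..?M}. \<forall>j\<in>C. A r j = u j}) = real ?M / real s ^ t"
      if C: "C \<subseteq> {1..k}" "card C = t" and u: "u \<in> C \<rightarrow>\<^sub>E {1..s}" for C u
    proof -
      have "real (card {r \<in> {1..?M}. \<forall>j\<in>C. A r j = u j}) =
          marginal s k (\<lambda>y. real (card {r \<in> {1..?M}. restrict (A r) {1..k} = y})) C u"
        by (rule marginal_row_frequency[symmetric]) (use As C in auto)
      also have "\<dots> = marginal s k N C u"
        unfolding marginal_def
      proof (intro sum.cong refl)
        fix y assume "y \<in> {y \<in> grid s k. \<forall>i\<in>C. y i = u i}"
        then have y: "y \<in> grid s k" by simp
        have "{r \<in> {1..?M}. restrict (A r) {1..k} = y} = {r \<in> {1..?M}. A r = y}"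
          using res by auto
        then show "real (card {r \<in> {1..?M}. restrict (A r) {1..k} = y}) = N y"
          using An[OF y] n[OF y] by simp
      qed
      also have "\<dots> = real lam" by (subst marg) (use C u in \<open>auto simp: PiE_def\<close>)
      finally show ?thesis using M by simp
    qed
    then have "is_OA ?M k s t A" using As by (auto simp: is_OA_def)
    then show "exists_OA ?M k s t" by (auto simp: exists_OA_def)
  }
qed

end
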